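(* Let $G=(V,E)$ be a simple undirected graph, let $S\subseteq\binom{V}{2}$ be a set of terminal pairs, and let $a^{\mathsf T}x\geq b$ be facet-defining for $\mathrm{MultC}(G,S)$ with $\{x:a^{\mathsf T}x\geq b\}\neq\{x:x_{e'}\geq 0\}$ for all $e'\in E$. Let $P\subseteq G$ be an induced path (i.e., every internal node of $P$ has degree $2$ in $G$) such that no internal node of $P$ is a terminal. Then $a_e=a_f$ for all $e,f\in E(P)$.
   Context: Given a graph $G=(V,E)$ and $S\subseteq\binom{V}{2}$, an ($S$-)multicut is a set $\delta\subseteq E$ such that for every $\{s,t\}\in S$ the nodes $s$ and $t$ lie in different components of $G-\delta$. A node $v$ is a terminal if $\{v,w\}\in S$ for some $w$. For $F\subseteq E$, $x^F\in\mathbb{R}^E$ is its incidence vector. The multicut dominant is $\mathrm{MultC}(G,S)=\mathrm{conv}\{x^\delta:\delta \text{ an } S\text{-multicut}\}+\mathbb{R}^E_{\geq 0}$. *)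

theory Defs
  imports "HOL-Analysis.Analysis" "HOL-Library.Ramsey"
begin

text \<open>A finite simple graph is a vertex set \<open>V\<close> together with an edge set
  \<open>E \<subseteq> [V]\<^bsup>2\<^esup>\<close>, so an edge is literally a two-element set of nodes.\<close>

definition simple_graph :: "'v set \<Rightarrow> 'v set set \<Rightarrow> bool" where
  "simple_graph V E \<longleftrightarrow> finite V \<and> E \<subseteq> [V]\<^bsup>2\<^esup>"

definition component_of :: "'v set \<Rightarrow> 'v set set \<Rightarrow> 'v \<Rightarrow> 'v set" where
  "component_of V E v = {w \<in> V. (v, w) \<in> {(x, y). {x, y} \<in> E}\<^sup>*}"

definition degree :: "'v set set \<Rightarrow> 'v \<Rightarrow> nat" where
  "degree E v = card {e \<in> E. v \<in> e}"

definition terminal :: "'v set set \<Rightarrow> 'v \<Rightarrow> bool" where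
  "terminal S v \<longleftrightarrow> (\<exists>w. {v, w} \<in> S)"

definition multicut :: "'v set \<Rightarrow> 'v set set \<Rightarrow> 'v set set \<Rightarrow> 'v set set \<Rightarrow> bool" where
  "multicut V E S \<delta> \<longleftrightarrow> \<delta> \<subseteq> E \<and>
     (\<forall>s t. {s, t} \<in> S \<longrightarrow> component_of V (E - \<delta>) s \<noteq> component_of V (E - \<delta>) t)"


text \<open>The space \<open>\<real>\<^sup>E\<close> is the coordinate subspace of \<open>real ^ ('v set)\<close> on which all
  coordinates outside \<open>E\<close> vanish. The notions of convex hull, face and facet are
  intrinsic to the affine hull and hence do not depend on this embedding.\<close>

definition edge_space :: "'v::finite set set \<Rightarrow> (real ^ ('v set)) set" where
  "edge_space E = {x. \<forall>e. e \<notin> E \<longrightarrow> x $ e = 0}"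

definition incidence_vec :: "'v::finite set set \<Rightarrow> real ^ ('v set)" where
  "incidence_vec F = (\<chi> e. if e \<in> F then 1 else 0)"

definition MultC :: "'v::finite set \<Rightarrow> 'v set set \<Rightarrow> 'v set set \<Rightarrow> (real ^ ('v set)) set" where
  "MultC V E S =
     {y + z | y z. y \<in> convex hull (incidence_vec ` {\<delta>. multicut V E S \<delta>})
                 \<and> z \<in> edge_space E \<and> (\<forall>e\<in>E. z $ e \<ge> 0)}"

definition facet_defining :: "'n::euclidean_space \<Rightarrow> real \<Rightarrow> 'n set \<Rightarrow> bool" where
  "facet_defining a b Q \<longleftrightarrow> (\<forall>x\<in>Q. a \<bullet> x \<ge> b) \<and> {x \<in> Q. a \<bullet> x = b} facet_of Q"


text \<open>A path in the graph is given by the list of its (pairwise distinct) nodes in order.\<close>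

definition path_in :: "'v set \<Rightarrow> 'v set set \<Rightarrow> 'v list \<Rightarrow> bool" where
  "path_in V E p \<longleftrightarrow> p \<noteq> [] \<and> distinct p \<and> set p \<subseteq> V \<and>
     (\<forall>i. Suc i < length p \<longrightarrow> {p ! i, p ! Suc i} \<in> E)"

definition path_edges :: "'v list \<Rightarrow> 'v set set" where
  "path_edges p = {{p ! i, p ! Suc i} | i. Suc i < length p}"

definition internal_nodes :: "'v list \<Rightarrow> 'v set" where
  "internal_nodes p = {p ! i | i. 0 < i \<and> Suc i < length p}"

text \<open>``Induced'' means here that all internal nodes have degree 2 in the whole graph;
  the two end nodes may be joined by an edge outside the path.\<close>

definition induced_path :: "'v set \<Rightarrow> 'v set set \<Rightarrow> 'v list \<Rightarrow> bool" where
  "induced_path V E p \<longleftrightarrow> path_in V E p \<and> (\<forall>v\<in>internal_nodes p. degree E v = 2)"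

end

theory Submission
  imports Defs
begin

text \<open>For consecutive path edges \<open>e\<close>, \<open>f\<close> meeting in an internal node, exchanging \<open>e\<close> for \<open>f\<close>
  turns multicuts into multicuts. If \<open>a\<^sub>f < a\<^sub>e\<close>, then even \<open>a \<bullet> x - (a\<^sub>e - a\<^sub>f) x\<^sub>e \<ge> b\<close> is
  valid for the multicut dominant, so the facet lies in the proper face given by \<open>x\<^sub>e = 0\<close> and
  hence equals it. That face is closed under adding the unit vectors other than the one of \<open>e\<close>,
  which forces \<open>a \<bullet> x \<ge> b\<close> to be a positive multiple of \<open>x\<^sub>e \<ge> 0\<close>.\<close>

lemma component_of_eq_iff:
  assumes "s \<in> V" "t \<in> V"
  shows "component_of V E s = component_of V E t \<longleftrightarrow> (s, t) \<in> {(x, y). {x, y} \<in> E}\<^sup>*"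
proof -
  have "sym ({(x, y). {x, y} \<in> E}\<^sup>*)"
    by (rule sym_rtrancl) (auto simp: sym_def insert_commute)
  then show ?thesis
    using assms unfolding component_of_def by (auto dest: symD intro: rtrancl_trans)
qed

text \<open>Every edge of \<open>E'\<close> at \<open>v\<close> leads to \<open>u\<close>, so a walk
  that enters \<open>v\<close> must return to \<open>u\<close>. Collapsing \<open>v\<close> onto
  \<open>u\<close> therefore turns the walk into one that avoids \<open>v\<close> and uses only
  edges of \<open>E\<close>.\<close>

lemma reachable_avoiding_pendant:
  assumes "(s, t) \<in> {(x, y). {x, y} \<in> E'}\<^sup>*"
    and "s \<noteq> v" "u \<noteq> v"
    and pendant: "\<And>g. g \<in> E' \<Longrightarrow> v \<in> g \<Longrightarrow> g = {u, v}"
    and sub: "\<And>g. g \<in> E' \<Longrightarrow> v \<notin> g \<Longrightarrow> g \<in> E"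
  shows "(s, if t = v then u else t) \<in> {(x, y). {x, y} \<in> E}\<^sup>*"
  using assms(1)
proof (induction rule: rtrancl_induct)
  case base
  then show ?case using \<open>s \<noteq> v\<close> by simp
next
  case (step y z)
  have yz: "{y, z} \<in> E'" using step by simp
  show ?case
  proof (cases "y = v \<or> z = v")
    case True
    then have "{y, z} = {u, v}" using pendant[OF yz] by auto
    \<comment> \<open>A step between \<open>u\<close> and \<open>v\<close> becomes stationary after
      the collapse, so the induction hypothesis already covers it.\<close>
    then have "(if z = v then u else z) = (if y = v then u else y)"
      using \<open>u \<noteq> v\<close> by (auto simp: doubleton_eq_iff)
    then show ?thesis using step.IH by simp
  next
    case False
    then have "{y, z} \<in> E" using sub[OF yz] by auto
    then show ?thesis using step.IH False by (auto intro: rtrancl_into_rtrancl)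
  qed
qed

text \<open>Once \<open>f\<close> is cut, at most the edge to \<open>u\<close> survives at
  \<open>v\<close>, so \<open>v\<close> is a dead end. As \<open>v\<close> is no terminal, a
  connection between terminals can bypass it and then uses only edges that the old multicut left
  intact.\<close>

lemma multicut_exchange:
  assumes "S \<subseteq> [V]\<^bsup>2\<^esup>" "multicut V E S \<delta>" "\<not> terminal S v" "u \<noteq> v" "f \<in> E"
    and inc: "{g \<in> E. v \<in> g} = {{u, v}, f}"
  shows "multicut V E S (insert f (\<delta> - {{u, v}}))"
  unfolding multicut_def
proof (intro conjI allI impI notI)
  show "insert f (\<delta> - {{u, v}}) \<subseteq> E"
    using assms unfolding multicut_def by auto
next
  fix s t
  let ?E' = "E - insert f (\<delta> - {{u, v}})"
  assume st: "{s, t} \<in> S"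
    and eq: "component_of V ?E' s = component_of V ?E' t"
  have V: "s \<in> V" "t \<in> V" using st assms(1) by (auto simp: nsets_def)
  have "s \<noteq> v" "t \<noteq> v"
    using st \<open>\<not> terminal S v\<close> unfolding terminal_def by (auto simp: insert_commute)
  have "(s, t) \<in> {(x, y). {x, y} \<in> ?E'}\<^sup>*"
    using eq component_of_eq_iff[OF V] by blast
  then have "(s, if t = v then u else t) \<in> {(x, y). {x, y} \<in> E - \<delta>}\<^sup>*"
    by (rule reachable_avoiding_pendant) (use \<open>s \<noteq> v\<close> \<open>u \<noteq> v\<close> inc in auto)
  then have "component_of V (E - \<delta>) s = component_of V (E - \<delta>) t"
    using \<open>t \<noteq> v\<close> component_of_eq_iff[OF V] by auto
  then show False using assms(2) st unfolding multicut_def by blast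
qed

text \<open>This provides a point of the dominant whose coordinates on \<open>E\<close> are all 1: a
  start for rays, and a witness that the face where one coordinate vanishes is proper.\<close>

lemma multicut_all_edges:
  assumes "S \<subseteq> [V]\<^bsup>2\<^esup>"
  shows "multicut V E S E"
  unfolding multicut_def
proof (intro conjI allI impI notI)
  fix s t
  assume st: "{s, t} \<in> S"
    and eq: "component_of V (E - E) s = component_of V (E - E) t"
  have "s \<in> V" "t \<in> V" "s \<noteq> t" using st assms by (auto simp: nsets_def)
  then show False using eq by (auto simp: component_of_def)
qed simp

lemma inner_incidence_vec: "a \<bullet> incidence_vec F = (\<Sum>e\<in>F. a $ e)"
  by (simp add: inner_vec_def incidence_vec_def if_distrib sum.If_cases cong: if_cong)

lemma convex_MultC: "convex (MultC V E S)"
proof -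
  let ?Z = "{z \<in> edge_space E. \<forall>e\<in>E. z $ e \<ge> 0}"
  have "MultC V E S = (\<Union>y\<in>convex hull (incidence_vec ` {\<delta>. multicut V E S \<delta>}). \<Union>z\<in>?Z. {y + z})"
    unfolding MultC_def by blast
  moreover have "convex ?Z"
    by (auto simp: convex_def edge_space_def)
  ultimately show ?thesis
    by (simp add: convex_sums convex_convex_hull)
qed

lemma MultC_add_axis:
  assumes "x \<in> MultC V E S" "g \<in> E" "t \<ge> 0"
  shows "x + axis g t \<in> MultC V E S"
proof -
  obtain y z where yz: "x = y + z" "y \<in> convex hull (incidence_vec ` {\<delta>. multicut V E S \<delta>})"
    "z \<in> edge_space E" "\<forall>e\<in>E. z $ e \<ge> 0"
    using assms(1) unfolding MultC_def by blast
  then have "x + axis g t = y + (z + axis g t)" "z + axis g t \<in> edge_space E"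
    "\<forall>e\<in>E. (z + axis g t) $ e \<ge> 0"
    using assms by (auto simp: edge_space_def axis_def)
  then show ?thesis using yz(2) unfolding MultC_def by blast
qed

lemma incidence_vec_in_MultC:
  assumes "multicut V E S \<delta>"
  shows "incidence_vec \<delta> \<in> MultC V E S"
proof -
  have "incidence_vec \<delta> = incidence_vec \<delta> + 0" by simp
  moreover have "incidence_vec \<delta> \<in> convex hull (incidence_vec ` {\<delta>. multicut V E S \<delta>})"
    using assms by (simp add: hull_inc)
  moreover have "0 \<in> edge_space E" "\<forall>e\<in>E. (0 :: real ^ ('a set)) $ e \<ge> 0"
    by (auto simp: edge_space_def)
  ultimately show ?thesis unfolding MultC_def by blast
qed

text \<open>It suffices to test the generators: the halfspace is convex, so it contains the hull,
  and nonnegative coefficients handle the recession directions.\<close>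

lemma MultC_valid_inequality:
  assumes mc: "\<And>\<delta>. multicut V E S \<delta> \<Longrightarrow> c \<bullet> incidence_vec \<delta> \<ge> b"
    and nonneg: "\<And>e. e \<in> E \<Longrightarrow> c $ e \<ge> 0"
    and "x \<in> MultC V E S"
  shows "c \<bullet> x \<ge> b"
proof -
  obtain y z where yz: "x = y + z" "y \<in> convex hull (incidence_vec ` {\<delta>. multicut V E S \<delta>})"
    "z \<in> edge_space E" "\<forall>e\<in>E. z $ e \<ge> 0"
    using assms(3) unfolding MultC_def by blast
  have "convex hull (incidence_vec ` {\<delta>. multicut V E S \<delta>}) \<subseteq> {y. c \<bullet> y \<ge> b}"
    by (rule hull_minimal) (use mc in \<open>auto simp: convex_halfspace_ge\<close>)
  then have "c \<bullet> y \<ge> b" using yz by blast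
  moreover have "c \<bullet> z \<ge> 0"
    unfolding inner_vec_def
  proof (rule sum_nonneg)
    show "c $ e \<bullet> z $ e \<ge> 0" for e
      using yz(3,4) nonneg by (cases "e \<in> E") (simp_all add: edge_space_def)
  qed
  ultimately show ?thesis by (simp add: yz inner_add_right)
qed

lemma MultC_nth_nonneg:
  assumes "x \<in> MultC V E S" "e \<in> E"
  shows "x $ e \<ge> 0"
proof -
  have "axis e 1 \<bullet> x \<ge> 0"
    by (rule MultC_valid_inequality[OF _ _ assms(1)])
      (auto simp: inner_axis', auto simp: incidence_vec_def axis_def)
  then show ?thesis by (simp add: inner_axis')
qed

text \<open>The dominant contains a ray in direction \<open>g\<close>, along which a negative
  coefficient would make \<open>a \<bullet> x\<close> unbounded below.\<close>

lemma MultC_valid_nonneg: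
  assumes "S \<subseteq> [V]\<^bsup>2\<^esup>" "\<And>x. x \<in> MultC V E S \<Longrightarrow> a \<bullet> x \<ge> b" "g \<in> E"
  shows "a $ g \<ge> 0"
proof (rule ccontr)
  assume neg: "\<not> a $ g \<ge> 0"
  let ?y = "incidence_vec E"
  \<comment> \<open>This step length brings the value of \<open>a\<close> down to exactly
    \<open>b - 1\<close>.\<close>
  define t where "t = (a \<bullet> ?y - b + 1) / - (a $ g)"
  have y: "?y \<in> MultC V E S"
    by (intro incidence_vec_in_MultC multicut_all_edges assms)
  have "t \<ge> 0"
    unfolding t_def using neg assms(2)[OF y] by (intro divide_nonneg_pos) auto
  then have "a \<bullet> (?y + axis g t) \<ge> b"
    by (intro assms MultC_add_axis y)
  moreover have "t * (a $ g) = - (a \<bullet> ?y - b + 1)"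
    unfolding t_def using neg by (simp add: field_simps)
  ultimately show False
    by (simp add: inner_add_right inner_axis mult.commute)
qed

lemma facet_in_coordinate_hyperplane:
  assumes S: "S \<subseteq> [V]\<^bsup>2\<^esup>" and a: "a \<in> edge_space E" and e: "e \<in> E" "a $ e > 0"
    and facet: "facet_defining a b (MultC V E S)"
    and zero: "\<And>x. x \<in> MultC V E S \<Longrightarrow> a \<bullet> x = b \<Longrightarrow> x $ e = 0"
  shows "{x \<in> edge_space E. a \<bullet> x \<ge> b} = {x \<in> edge_space E. x $ e \<ge> 0}"
proof -
  let ?Q = "MultC V E S"
  define F where "F = {x \<in> ?Q. a \<bullet> x = b}"
  define F' where "F' = {x \<in> ?Q. x $ e = 0}"
  have F: "F face_of ?Q" "F \<noteq> {}" "aff_dim F = aff_dim ?Q - 1"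
    using facet unfolding facet_defining_def facet_of_def F_def by auto
  have "F' = ?Q \<inter> {x. axis e 1 \<bullet> x = 0}"
    by (auto simp: F'_def inner_axis')
  moreover have "(?Q \<inter> {x. axis e 1 \<bullet> x = 0}) face_of ?Q"
    by (rule face_of_Int_supporting_hyperplane_ge)
      (use e in \<open>auto simp: convex_MultC inner_axis' intro: MultC_nth_nonneg\<close>)
  ultimately have F': "F' face_of ?Q" by simp
  have "incidence_vec E \<in> ?Q"
    by (intro incidence_vec_in_MultC multicut_all_edges S)
  moreover have "incidence_vec E \<notin> F'"
    using e by (simp add: F'_def incidence_vec_def)
  ultimately have "aff_dim F' < aff_dim ?Q"
    using face_of_aff_dim_lt[OF convex_MultC F'] by metis
  moreover have "F \<subseteq> F'" using zero by (auto simp: F_def F'_def)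
  moreover have "F face_of F'"
    using face_of_subset[OF F(1) \<open>F \<subseteq> F'\<close>] face_of_imp_subset[OF F'] by blast
  moreover have "convex F'" using F' by (rule face_of_imp_convex)
  \<comment> \<open>If \<open>F\<close> were a proper face of \<open>F'\<close>, its dimension would
    be at least two below that of \<open>?Q\<close>, but a facet has codimension one.\<close>
  ultimately have eq: "F = F'"
    using face_of_aff_dim_lt[of F' F] F(3) by linarith
  obtain x where x: "x \<in> F" using F(2) by blast
  have "a $ g = 0" if "g \<noteq> e" for g
  proof (cases "g \<in> E")
    case True
    \<comment> \<open>Moving along \<open>g\<close> leaves coordinate \<open>e\<close> at 0, hence
      stays in the facet, where \<open>a\<close> is constant.\<close>
    have "x + axis g 1 \<in> F'"
      using x that True MultC_add_axis[of x V E S g 1] unfolding eq F'_def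
      by (auto simp: axis_def)
    then have "a \<bullet> (x + axis g 1) = b" "a \<bullet> x = b"
      using x eq unfolding F_def by auto
    then show ?thesis by (simp add: inner_add_right inner_axis)
  qed (use a in \<open>simp add: edge_space_def\<close>)
  then have "a = axis e (a $ e)" by (simp add: vec_eq_iff axis_def)
  then have inner: "a \<bullet> y = a $ e * y $ e" for y
    by (metis inner_axis' inner_real_def)
  have "b = 0"
    using x zero inner[of x] unfolding F_def by auto
  then show ?thesis
    using e by (auto simp: inner zero_le_mult_iff)
qed

lemma coefficient_le_at_degree_two_node:
  assumes S: "S \<subseteq> [V]\<^bsup>2\<^esup>" and a: "a \<in> edge_space E"
    and facet: "facet_defining a b (MultC V E S)"
    and nontriv: "\<forall>e'\<in>E. {x \<in> edge_space E. a \<bullet> x \<ge> b} \<noteq> {x \<in> edge_space E. x $ e' \<ge> 0}"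
    and v: "\<not> terminal S v" "u \<noteq> v"
    and inc: "{g \<in> E. v \<in> g} = {{u, v}, f}"
  shows "a $ {u, v} \<le> a $ f"
proof (rule ccontr)
  assume "\<not> a $ {u, v} \<le> a $ f"
  then have less: "a $ f < a $ {u, v}" by simp
  let ?e = "{u, v}"
  have E: "?e \<in> E" "f \<in> E" using inc by blast+
  have valid: "a \<bullet> x \<ge> b" if "x \<in> MultC V E S" for x
    using facet that unfolding facet_defining_def by blast
  have nonneg: "a $ g \<ge> 0" if "g \<in> E" for g
    using MultC_valid_nonneg[OF S valid that] .
  \<comment> \<open>The exchange lowers the weight by at least \<open>d\<close>, and subtracting
    \<open>d\<close> from the coefficient of \<open>?e\<close> leaves \<open>a $ f\<close>, which is
    still nonnegative.\<close>
  define d where "d = a $ ?e - a $ f"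
  have d: "d > 0" using less by (simp add: d_def)
  have strong_mc: "a \<bullet> incidence_vec \<delta> - d * incidence_vec \<delta> $ ?e \<ge> b" if mc: "multicut V E S \<delta>" for \<delta>
  proof (cases "?e \<in> \<delta>")
    case True
    have "multicut V E S (insert f (\<delta> - {?e}))"
      using multicut_exchange[OF S mc v E(2) inc] .
    then have "b \<le> (\<Sum>g\<in>insert f (\<delta> - {?e}). a $ g)"
      using valid incidence_vec_in_MultC inner_incidence_vec by metis
    \<comment> \<open>Only an inequality: \<open>f\<close> may already lie in the multicut, and then
      its nonnegative weight is counted twice on the right.\<close>
    also have "\<dots> \<le> a $ f + (\<Sum>g\<in>\<delta> - {?e}. a $ g)"
      using nonneg[OF E(2)] by (cases "f \<in> \<delta> - {?e}") (simp_all add: insert_absorb)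
    also have "\<dots> = a $ f + ((\<Sum>g\<in>\<delta>. a $ g) - a $ ?e)"
      using True by (simp add: sum_diff1)
    finally show ?thesis using True
      by (simp add: inner_incidence_vec d_def) (simp add: incidence_vec_def)
  next
    case False
    then show ?thesis
      using valid[OF incidence_vec_in_MultC[OF mc]] by (simp add: incidence_vec_def)
  qed
  have strong: "(a - axis ?e d) \<bullet> x \<ge> b" if "x \<in> MultC V E S" for x
  proof (rule MultC_valid_inequality[OF _ _ that])
    show "(a - axis ?e d) $ g \<ge> 0" if "g \<in> E" for g
      using nonneg[OF that] nonneg[OF E(2)] by (simp add: axis_def d_def)
  qed (use strong_mc in \<open>simp add: inner_diff_left inner_axis'\<close>)
  have "x $ ?e = 0" if "x \<in> MultC V E S" "a \<bullet> x = b" for x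
  proof -
    have "d * x $ ?e \<le> 0"
      using strong[OF that(1)] that(2) by (simp add: inner_diff_left inner_axis')
    then show ?thesis
      using d MultC_nth_nonneg[OF that(1) E(1)] by (simp add: mult_le_0_iff)
  qed
  moreover have "a $ ?e > 0" using less nonneg[OF E(2)] by simp
  ultimately show False
    using facet_in_coordinate_hyperplane[OF S a E(1) _ facet] nontriv E(1) by blast
qed

text \<open>The exchange works in both directions, so the one-sided bound applies again with
  \<open>u\<close> and \<open>w\<close> swapped.\<close>

lemma coefficient_eq_at_degree_two_node:
  assumes "S \<subseteq> [V]\<^bsup>2\<^esup>" "a \<in> edge_space E" "facet_defining a b (MultC V E S)"
    and "\<forall>e'\<in>E. {x \<in> edge_space E. a \<bullet> x \<ge> b} \<noteq> {x \<in> edge_space E. x $ e' \<ge> 0}"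
    and "\<not> terminal S v" "u \<noteq> v" "w \<noteq> v"
    and inc: "{g \<in> E. v \<in> g} = {{u, v}, {v, w}}"
  shows "a $ {u, v} = a $ {v, w}"
proof (rule antisym)
  show "a $ {u, v} \<le> a $ {v, w}"
    using coefficient_le_at_degree_two_node[OF assms(1-6) inc] .
  have "{g \<in> E. v \<in> g} = {{w, v}, {u, v}}" using inc by (simp add: insert_commute)
  then show "a $ {v, w} \<le> a $ {u, v}"
    using coefficient_le_at_degree_two_node[OF assms(1-5,7)] by (simp add: insert_commute)
qed

theorem theorem3p4:
  fixes V :: "'v::finite set"
    and E S :: "'v set set"
    and a :: "real ^ ('v set)"
    and b :: real
    and p :: "'v list"
  assumes "simple_graph V E"
    and "S \<subseteq> [V]\<^bsup>2\<^esup>"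
    and "a \<in> edge_space E"
    and "facet_defining a b (MultC V E S)"
    and "\<forall>e'\<in>E. {x \<in> edge_space E. a \<bullet> x \<ge> b} \<noteq> {x \<in> edge_space E. x $ e' \<ge> 0}"
    and "induced_path V E p"
    and "\<forall>v\<in>internal_nodes p. \<not> terminal S v"
  shows "\<forall>e\<in>path_edges p. \<forall>f\<in>path_edges p. a $ e = a $ f"
proof -
  have path: "distinct p" "\<And>i. Suc i < length p \<Longrightarrow> {p ! i, p ! Suc i} \<in> E"
    and deg: "\<And>v. v \<in> internal_nodes p \<Longrightarrow> degree E v = 2"
    using assms(6) unfolding induced_path_def path_in_def by auto
  \<comment> \<open>All coefficients are compared with that of the first path edge; the induction
    passes one internal node at a time.\<close>
  have first: "a $ {p ! i, p ! Suc i} = a $ {p ! 0, p ! Suc 0}" if "Suc i < length p" for i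
    using that
  proof (induction i)
    case (Suc i)
    let ?u = "p ! i" and ?v = "p ! Suc i" and ?w = "p ! Suc (Suc i)"
    have ne: "?u \<noteq> ?v" "?w \<noteq> ?v" "?u \<noteq> ?w"
      using Suc.prems path(1) by (auto simp: nth_eq_iff_index_eq)
    have int: "?v \<in> internal_nodes p"
      using Suc.prems unfolding internal_nodes_def by blast
    \<comment> \<open>The two path edges at \<open>?v\<close> are distinct because \<open>?u\<close>
      and \<open>?w\<close> are, so degree 2 leaves room for no other edge.\<close>
    have "{{?u, ?v}, {?v, ?w}} = {g \<in> E. ?v \<in> g}"
    proof (rule card_subset_eq)
      show "{{?u, ?v}, {?v, ?w}} \<subseteq> {g \<in> E. ?v \<in> g}"
        using path(2) Suc.prems by auto
      show "card {{?u, ?v}, {?v, ?w}} = card {g \<in> E. ?v \<in> g}"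
        using deg[OF int] ne by (simp add: degree_def doubleton_eq_iff)
    qed simp
    then have "a $ {?u, ?v} = a $ {?v, ?w}"
      using coefficient_eq_at_degree_two_node[OF assms(2-5) _ ne(1,2)] assms(7) int by auto
    then show ?case using Suc by simp
  qed simp
  have "a $ e = a $ {p ! 0, p ! Suc 0}" if "e \<in> path_edges p" for e
    using that first unfolding path_edges_def by blast
  then show ?thesis by metis
qed

end
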